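(* Let $$p^*=\inf_{(\mu_1,\dots,\mu_m)}\ \sum_{j=1}^m\int_K l_j\,\mathrm{d}\mu_j$$ subject to $\mu_j\in\mathcal{M}^+(K)$, $j=1,\dots,m$, and $$v(T,x_T)-v(0,x_0)=\sum_{j=1}^m\int_K\Big(\frac{\partial v}{\partial t}+\frac{\partial v}{\partial x}\cdot f_j\Big)\mathrm{d}\mu_j\quad\text{for all } v\in C^1(K),$$ and let $$d^*=\sup_{v\in C^1(K)}\ v(T,x_T)-v(0,x_0)$$ subject to $$l_j(t,x)-\frac{\partial v}{\partial t}(t,x)-\frac{\partial v}{\partial x}(t,x)\cdot f_j(t,x)\ \ge 0\quad\text{for all }(t,x)\in K,\ j=1,\dots,m.$$ Then there is no duality gap between these two linear programs: if there is an admissible vector $(\mu_1,\dots,\mu_m)$ for the first problem, then $p^*=d^*$.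
   Context: Standing setting: $T>0$, $x_0,x_T\in\mathbb{R}^n$ are given; $X\subset\mathbb{R}^n$ is a given compact set and $K:=[0,T]\times X$; for $j=1,\dots,m$ the functions $f_j:K\to\mathbb{R}^n$ and $l_j:K\to\mathbb{R}$ are continuous in all their variables and Lipschitz continuous with respect to the state variable $x$. $\mathcal{M}^+(K)$ is the cone of finite non-negative Borel measures on $K$. $C^1(K)$ denotes the continuously differentiable functions $v(t,x)$, understood as functions in $C^1(\mathbb{R}\times\mathbb{R}^n)$ whose derivatives are evaluated on $K$. A vector of measures is admissible if it satisfies all the constraints of the problem. *)

theory Defs
  imports "HOL-Analysis.Analysis"
begin

definition time_state_set :: "real \<Rightarrow> (real ^ 'n) set \<Rightarrow> (real \<times> (real ^ 'n)) set" where
  "time_state_set T X = {0..T} \<times> X"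

definition continuously_differentiable :: "(real \<times> (real ^ 'n) \<Rightarrow> real) \<Rightarrow> bool" where
  "continuously_differentiable v \<longleftrightarrow>
     (\<exists>D :: real \<times> (real ^ 'n) \<Rightarrow> (real \<times> (real ^ 'n)) \<Rightarrow>\<^sub>L real.
        (\<forall>p. (v has_derivative blinfun_apply (D p)) (at p)) \<and> continuous_on UNIV D)"

definition partial_t :: "(real \<times> (real ^ 'n) \<Rightarrow> real) \<Rightarrow> real \<times> (real ^ 'n) \<Rightarrow> real" where
  "partial_t v = (\<lambda>(t, x). deriv (\<lambda>s. v (s, x)) t)"

(* The row vector of partial derivatives in the state variable, as a linear form:
   applying it to w is the product of that row vector with w. *)
definition partial_x :: "(real \<times> (real ^ 'n) \<Rightarrow> real) \<Rightarrow> real \<times> (real ^ 'n) \<Rightarrow> real ^ 'n \<Rightarrow> real" where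
  "partial_x v = (\<lambda>(t, x). frechet_derivative (\<lambda>y. v (t, y)) (at x))"

definition nonneg_borel_measures :: "'a::topological_space set \<Rightarrow> 'a measure set" where
  "nonneg_borel_measures K = {\<mu>. finite_measure \<mu> \<and> sets \<mu> = sets (restrict_space borel K)}"

(* Only the entries 1, ..., m of the families mu, f and l matter, and f and l
   matter only on K, the underlying space of each measure. *)
definition primal_admissible ::
  "real \<Rightarrow> (real ^ 'n) set \<Rightarrow> real ^ 'n \<Rightarrow> real ^ 'n \<Rightarrow> nat
   \<Rightarrow> (nat \<Rightarrow> real \<times> (real ^ 'n) \<Rightarrow> real ^ 'n)
   \<Rightarrow> (nat \<Rightarrow> (real \<times> (real ^ 'n)) measure) \<Rightarrow> bool" where
  "primal_admissible T X x0 xT m f \<mu> \<longleftrightarrow>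
     (\<forall>j\<in>{1..m}. \<mu> j \<in> nonneg_borel_measures (time_state_set T X)) \<and>
     (\<forall>v. continuously_differentiable v \<longrightarrow>
        v (T, xT) - v (0, x0) =
        (\<Sum>j=1..m. LINT p|\<mu> j. partial_t v p + partial_x v p (f j p)))"

definition dual_admissible ::
  "real \<Rightarrow> (real ^ 'n) set \<Rightarrow> nat
   \<Rightarrow> (nat \<Rightarrow> real \<times> (real ^ 'n) \<Rightarrow> real ^ 'n) \<Rightarrow> (nat \<Rightarrow> real \<times> (real ^ 'n) \<Rightarrow> real)
   \<Rightarrow> (real \<times> (real ^ 'n) \<Rightarrow> real) \<Rightarrow> bool" where
  "dual_admissible T X m f l v \<longleftrightarrow>
     continuously_differentiable v \<and>
     (\<forall>j\<in>{1..m}. \<forall>p\<in>time_state_set T X. l j p - partial_t v p - partial_x v p (f j p) \<ge> 0)"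

definition primal_value ::
  "real \<Rightarrow> (real ^ 'n) set \<Rightarrow> real ^ 'n \<Rightarrow> real ^ 'n \<Rightarrow> nat
   \<Rightarrow> (nat \<Rightarrow> real \<times> (real ^ 'n) \<Rightarrow> real ^ 'n) \<Rightarrow> (nat \<Rightarrow> real \<times> (real ^ 'n) \<Rightarrow> real) \<Rightarrow> ereal" where
  "primal_value T X x0 xT m f l =
     (INF \<mu>\<in>{\<mu>. primal_admissible T X x0 xT m f \<mu>}. ereal (\<Sum>j=1..m. LINT p|\<mu> j. l j p))"

definition dual_value ::
  "real \<Rightarrow> (real ^ 'n) set \<Rightarrow> real ^ 'n \<Rightarrow> real ^ 'n \<Rightarrow> nat
   \<Rightarrow> (nat \<Rightarrow> real \<times> (real ^ 'n) \<Rightarrow> real ^ 'n) \<Rightarrow> (nat \<Rightarrow> real \<times> (real ^ 'n) \<Rightarrow> real) \<Rightarrow> ereal" where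
  "dual_value T X x0 xT m f l =
     (SUP v\<in>{v. dual_admissible T X m f l v}. ereal (v (T, xT) - v (0, x0)))"

end

theory Submission imports Defs begin

text \<open>The inequality between the dual and the primal value is obtained by integrating the dual
  constraint against an admissible vector. For the converse, an optimal vector of measures is
  constructed from the dual problem alone.

  Let \<open>price h\<close> be the infimum of \<open>v(T, xT) - v(0, x0)\<close> over the test functions \<open>v\<close> whose
  rates of change along all vector fields dominate the family \<open>h = (h_1, ..., h_m)\<close> of continuous
  functions on \<open>K\<close>. It is sublinear. It is finite: constants are the rates of multiples of the
  time variable, so compactness of \<open>K\<close> yields a dominating test function, and an admissible vector
  of measures bounds the infimum from below. The dual value is \<open>- price (- l)\<close>.

  The Hahn--Banach theorem (\<open>Hahn_Banach_sublinear\<close>) gives a linear functional \<open>F\<close> below the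
  price that agrees with it at \<open>- l\<close>. As the zero function dominates nonpositive families,
  \<open>F\<close> is positive, and the Riesz representation theorem (\<open>integral_representing_measure\<close>,
  \<open>Riesz_representation_family\<close>) turns it into a vector of measures. As each test function
  dominates its own rates, \<open>F\<close> is at most \<open>v(T, xT) - v(0, x0)\<close> there, and replacing
  \<open>v\<close> by \<open>- v\<close> gives equality: the vector of measures is admissible
  (\<open>ex_measures_attaining_price\<close>). Its cost is \<open>F l = - price (- l)\<close>, the dual value.

  Hahn--Banach is proved on spaces of real functions by finding a minimal sublinear functional.
  The representing measure is the Caratheodory restriction of the outer measure generated by the
  content of open sets, the supremum of the functional over continuous functions below the
  indicator.\<close>

section \<open>Linear functionals below sublinear ones\<close>

definition function_subspace :: "('b \<Rightarrow> real) set \<Rightarrow> bool" where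
  "function_subspace V \<longleftrightarrow> V \<noteq> {} \<and> (\<forall>g\<in>V. \<forall>h\<in>V. (\<lambda>x. g x + h x) \<in> V)
     \<and> (\<forall>h\<in>V. \<forall>c. (\<lambda>x. c * h x) \<in> V)"

text \<open>Only one inequality is demanded for the scaling; applied to \<open>c\<close> and \<open>1 / c\<close> it gives
  equality, and it is easier to verify for infima.\<close>
definition sublinear_on :: "('b \<Rightarrow> real) set \<Rightarrow> (('b \<Rightarrow> real) \<Rightarrow> real) \<Rightarrow> bool" where
  "sublinear_on V q \<longleftrightarrow> (\<forall>g\<in>V. \<forall>h\<in>V. q (\<lambda>x. g x + h x) \<le> q g + q h)
     \<and> (\<forall>h\<in>V. \<forall>c>0. q (\<lambda>x. c * h x) \<le> c * q h)"

definition linear_functional_on :: "('b \<Rightarrow> real) set \<Rightarrow> (('b \<Rightarrow> real) \<Rightarrow> real) \<Rightarrow> bool" where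
  "linear_functional_on V F \<longleftrightarrow> (\<forall>g\<in>V. \<forall>h\<in>V. F (\<lambda>x. g x + h x) = F g + F h)
     \<and> (\<forall>h\<in>V. \<forall>c. F (\<lambda>x. c * h x) = c * F h)"

lemma function_subspace_add:
  "function_subspace V \<Longrightarrow> g \<in> V \<Longrightarrow> h \<in> V \<Longrightarrow> (\<lambda>x. g x + h x) \<in> V"
  by (simp add: function_subspace_def)

lemma function_subspace_scale:
  "function_subspace V \<Longrightarrow> h \<in> V \<Longrightarrow> (\<lambda>x. c * h x) \<in> V"
  by (simp add: function_subspace_def)

lemma sublinear_on_add:
  "sublinear_on V q \<Longrightarrow> g \<in> V \<Longrightarrow> h \<in> V \<Longrightarrow> q (\<lambda>x. g x + h x) \<le> q g + q h"
  by (simp add: sublinear_on_def)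

lemma sublinear_on_scale_le:
  "sublinear_on V q \<Longrightarrow> h \<in> V \<Longrightarrow> c > 0 \<Longrightarrow> q (\<lambda>x. c * h x) \<le> c * q h"
  by (simp add: sublinear_on_def)

lemma function_subspace_zero: "function_subspace V \<Longrightarrow> (\<lambda>x. 0) \<in> V"
  using function_subspace_scale[of V _ 0] unfolding function_subspace_def by auto

lemma function_subspace_uminus: "function_subspace V \<Longrightarrow> h \<in> V \<Longrightarrow> (\<lambda>x. - h x) \<in> V"
  using function_subspace_scale[of V h "-1"] by simp

lemma sublinear_on_scale:
  assumes V: "function_subspace V" and q: "sublinear_on V q" and h: "h \<in> V" and c: "c \<ge> 0"
  shows "q (\<lambda>x. c * h x) = c * q h"
proof (cases "c = 0")
  case True
  have z: "(\<lambda>x. 0) \<in> V" by (rule function_subspace_zero[OF V])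
  have le: "q (\<lambda>x. d * 0) \<le> d * q (\<lambda>x. 0)" if "d > 0" for d
    by (rule sublinear_on_scale_le[OF q z that])
  have "q (\<lambda>x. 0) = 0" using le[of 2] le[of "1/2"] by simp
  with True show ?thesis by simp
next
  case False
  with c have c: "c > 0" by simp
  have ch: "(\<lambda>x. c * h x) \<in> V" by (rule function_subspace_scale[OF V h])
  have "q (\<lambda>x. inverse c * (c * h x)) \<le> inverse c * q (\<lambda>x. c * h x)"
    using c by (intro sublinear_on_scale_le[OF q ch]) simp
  moreover have "(\<lambda>x. inverse c * (c * h x)) = h" using c by auto
  ultimately have "c * q h \<le> q (\<lambda>x. c * h x)" using c by (simp add: field_simps)
  moreover have "q (\<lambda>x. c * h x) \<le> c * q h" by (rule sublinear_on_scale_le[OF q h c])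
  ultimately show ?thesis by simp
qed

lemma sublinear_on_neg_le:
  assumes V: "function_subspace V" and q: "sublinear_on V q" and h: "h \<in> V"
  shows "- q (\<lambda>x. - h x) \<le> q h"
proof -
  have "q (\<lambda>x. h x + - h x) \<le> q h + q (\<lambda>x. - h x)"
    by (rule sublinear_on_add[OF q h function_subspace_uminus[OF V h]])
  moreover have "q (\<lambda>x. 0) = 0"
    using sublinear_on_scale[OF V q h, of 0] by simp
  ultimately show ?thesis by simp
qed

text \<open>The largest sublinear functional below \<open>q\<close> whose value at \<open>- z\<close> is at most
  \<open>- q z\<close>: lowering \<open>q\<close> in this way forces it to be additive in the direction
  \<open>z\<close>.\<close>
definition lowered :: "(('b \<Rightarrow> real) \<Rightarrow> real) \<Rightarrow> ('b \<Rightarrow> real) \<Rightarrow> ('b \<Rightarrow> real) \<Rightarrow> real"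
  where "lowered q z h = (INF t\<in>{0..}. q (\<lambda>x. h x + t * z x) - t * q z)"

context
  fixes V :: "('b \<Rightarrow> real) set" and q z
  assumes V: "function_subspace V" and q: "sublinear_on V q" and z: "z \<in> V"
begin

lemma lowered_le:
  assumes h: "h \<in> V" and "t \<ge> 0"
  shows "lowered q z h \<le> q (\<lambda>x. h x + t * z x) - t * q z"
proof -
  have "- q (\<lambda>x. - h x) \<le> q (\<lambda>x. h x + s * z x) - s * q z" if "s \<ge> 0" for s
  proof -
    have V1: "(\<lambda>x. h x + s * z x) \<in> V" "(\<lambda>x. - h x) \<in> V"
      using V h z function_subspace_uminus[OF V h] unfolding function_subspace_def by simp_all
    have "q (\<lambda>x. (h x + s * z x) + - h x) \<le> q (\<lambda>x. h x + s * z x) + q (\<lambda>x. - h x)"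
      by (rule sublinear_on_add[OF q V1])
    then show ?thesis using sublinear_on_scale[OF V q z that] by simp
  qed
  then have "bdd_below ((\<lambda>t. q (\<lambda>x. h x + t * z x) - t * q z) ` {0..})"
    by (intro bdd_belowI2[of _ "- q (\<lambda>x. - h x)"]) auto
  then show ?thesis using assms unfolding lowered_def by (auto intro: cINF_lower)
qed

lemma lowered_greatest:
  assumes "\<And>t. t \<ge> 0 \<Longrightarrow> a \<le> q (\<lambda>x. h x + t * z x) - t * q z"
  shows "a \<le> lowered q z h"
  using assms unfolding lowered_def by (auto intro!: cINF_greatest)

lemma sublinear_on_lowered: "sublinear_on V (lowered q z)"
proof -
  have "lowered q z (\<lambda>x. g x + h x) \<le> lowered q z g + lowered q z h"
    if g: "g \<in> V" and h: "h \<in> V" for g h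
  proof -
    have gh: "(\<lambda>x. g x + h x) \<in> V" by (rule function_subspace_add[OF V g h])
    have *: "lowered q z (\<lambda>x. g x + h x)
        \<le> (q (\<lambda>x. g x + s * z x) - s * q z) + (q (\<lambda>x. h x + t * z x) - t * q z)"
      if "s \<ge> 0" "t \<ge> 0" for s t
    proof -
      have V1: "(\<lambda>x. g x + s * z x) \<in> V" "(\<lambda>x. h x + t * z x) \<in> V"
        using V g h z unfolding function_subspace_def by simp_all
      have "q (\<lambda>x. (g x + s * z x) + (h x + t * z x))
          \<le> q (\<lambda>x. g x + s * z x) + q (\<lambda>x. h x + t * z x)"
        by (rule sublinear_on_add[OF q V1])
      moreover have "(\<lambda>x. (g x + s * z x) + (h x + t * z x)) = (\<lambda>x. g x + h x + (s + t) * z x)"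
        by (auto simp: algebra_simps)
      ultimately show ?thesis
        using lowered_le[OF gh, of "s + t"] that by (simp add: algebra_simps)
    qed
    have "lowered q z (\<lambda>x. g x + h x) - lowered q z h \<le> lowered q z g"
    proof (rule lowered_greatest)
      fix s :: real assume s: "s \<ge> 0"
      have "lowered q z (\<lambda>x. g x + h x) - (q (\<lambda>x. g x + s * z x) - s * q z) \<le> lowered q z h"
        by (rule lowered_greatest) (use *[OF s] in \<open>simp add: algebra_simps\<close>)
      then show "lowered q z (\<lambda>x. g x + h x) - lowered q z h
          \<le> q (\<lambda>x. g x + s * z x) - s * q z" by simp
    qed
    then show ?thesis by simp
  qed
  moreover have "lowered q z (\<lambda>x. c * h x) \<le> c * lowered q z h"
    if h: "h \<in> V" and c: "c > 0" for h c
  proof -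
    have ch: "(\<lambda>x. c * h x) \<in> V" by (rule function_subspace_scale[OF V h])
    have "lowered q z (\<lambda>x. c * h x) / c \<le> lowered q z h"
    proof (rule lowered_greatest)
      fix t :: real assume t: "t \<ge> 0"
      have "(\<lambda>x. h x + t * z x) \<in> V" using V h z unfolding function_subspace_def by simp
      from sublinear_on_scale[OF V q this, of c] c
      have "q (\<lambda>x. c * h x + (c * t) * z x) = c * q (\<lambda>x. h x + t * z x)"
        by (simp add: algebra_simps)
      with lowered_le[OF ch, of "c * t"] c t
      show "lowered q z (\<lambda>x. c * h x) / c \<le> q (\<lambda>x. h x + t * z x) - t * q z"
        by (simp add: field_simps)
    qed
    then show ?thesis using c by (simp add: field_simps)
  qed
  ultimately show ?thesis unfolding sublinear_on_def by blast
qed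

end

text \<open>Lowering a minimal functional in any direction cannot change it, so it is additive in every
  direction.\<close>
lemma linear_functional_on_minimal_sublinear:
  assumes V: "function_subspace V" and q: "sublinear_on V q"
    and min: "\<And>r. sublinear_on V r \<Longrightarrow> (\<And>h. h \<in> V \<Longrightarrow> r h \<le> q h) \<Longrightarrow> (\<And>h. h \<in> V \<Longrightarrow> r h = q h)"
  shows "linear_functional_on V q"
proof -
  have add: "q (\<lambda>x. g x + h x) = q g + q h" if g: "g \<in> V" and h: "h \<in> V" for g h
  proof -
    have "lowered q h k \<le> q k" if "k \<in> V" for k
      using lowered_le[OF V q h that, of 0] by simp
    from min[OF sublinear_on_lowered[OF V q h] this g] lowered_le[OF V q h g, of 1]
    have "q g \<le> q (\<lambda>x. g x + h x) - q h" by simp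
    moreover have "q (\<lambda>x. g x + h x) \<le> q g + q h"
      by (rule sublinear_on_add[OF q g h])
    ultimately show ?thesis by simp
  qed
  have "q (\<lambda>x. c * h x) = c * q h" if h: "h \<in> V" for h c
  proof (cases "c \<ge> 0")
    case True then show ?thesis by (rule sublinear_on_scale[OF V q h])
  next
    case False
    have ch: "(\<lambda>x. c * h x) \<in> V" "(\<lambda>x. - c * h x) \<in> V"
      by (rule function_subspace_scale[OF V h])+
    have "q (\<lambda>x. 0) = 0" using sublinear_on_scale[OF V q h, of 0] by simp
    with add[OF ch] have "q (\<lambda>x. c * h x) = - q (\<lambda>x. - c * h x)" by simp
    also have "\<dots> = c * q h" using sublinear_on_scale[OF V q h, of "- c"] False by simp
    finally show ?thesis .
  qed
  with add show ?thesis unfolding linear_functional_on_def by blast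
qed

text \<open>Zorn's lemma: the pointwise infimum of a chain is sublinear, since any two members have a
  common lower bound inside the chain, and it is finite since every member is at least
  \<open>- p (- h)\<close>.\<close>
lemma ex_minimal_sublinear:
  fixes p :: "('b \<Rightarrow> real) \<Rightarrow> real"
  assumes V: "function_subspace V" and p: "sublinear_on V p"
  obtains q where "sublinear_on V q" "\<And>h. h \<in> V \<Longrightarrow> q h \<le> p h"
    "\<And>r h. sublinear_on V r \<Longrightarrow> (\<And>k. k \<in> V \<Longrightarrow> r k \<le> q k) \<Longrightarrow> h \<in> V \<Longrightarrow> r h = q h"
proof -
  \<comment> \<open>Fixing the values off \<open>V\<close> makes the pointwise order antisymmetric on \<open>S\<close>.\<close>
  define S where "S = {q. sublinear_on V q \<and> (\<forall>h\<in>V. q h \<le> p h) \<and> (\<forall>h. h \<notin> V \<longrightarrow> q h = 0)}"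
  let ?R = "relation_of (\<lambda>a b. b \<le> a) S"
  define cut where "cut r = (\<lambda>h. if h \<in> V then r h else 0)" for r :: "('b \<Rightarrow> real) \<Rightarrow> real"
  have cut: "cut r \<in> S" if "sublinear_on V r" "\<forall>h\<in>V. r h \<le> p h" for r
    using that V unfolding S_def cut_def sublinear_on_def function_subspace_def by auto
  have "\<exists>q\<in>S. \<forall>r\<in>S. r \<le> q \<longrightarrow> r = q"
  proof (rule predicate_Zorn)
    show "partial_order_on S ?R"
      by (rule partial_order_on_relation_ofI) auto
  next
    fix C assume C: "C \<in> Chains ?R"
    then have CS: "C \<subseteq> S" unfolding Chains_def relation_of_def by auto
    have ch: "a \<le> b \<or> b \<le> a" if "a \<in> C" "b \<in> C" for a b
      using C that unfolding Chains_def relation_of_def by auto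
    show "\<exists>u\<in>S. \<forall>a\<in>C. u \<le> a"
    proof (cases "C = {}")
      case True
      then show ?thesis using cut[OF p] by auto
    next
      case ne: False
      define u where "u = (\<lambda>h. if h \<in> V then INF q\<in>C. q h else 0)"
      have lower: "u h \<le> q h" if "q \<in> C" "h \<in> V" for q h
      proof -
        have "- p (\<lambda>x. - h x) \<le> r h" if r: "r \<in> C" for r
        proof -
          have "sublinear_on V r" "r (\<lambda>x. - h x) \<le> p (\<lambda>x. - h x)"
            using r CS function_subspace_uminus[OF V \<open>h \<in> V\<close>] unfolding S_def by auto
          with sublinear_on_neg_le[OF V _ \<open>h \<in> V\<close>, of r] show ?thesis by simp
        qed
        then have "bdd_below ((\<lambda>q. q h) ` C)"
          by (intro bdd_belowI2[of _ "- p (\<lambda>x. - h x)"]) auto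
        then show ?thesis using that unfolding u_def by (auto intro: cINF_lower)
      qed
      have greatest: "a \<le> u h" if "h \<in> V" "\<And>q. q \<in> C \<Longrightarrow> a \<le> q h" for a h
        using that ne unfolding u_def by (auto intro!: cINF_greatest)
      have sub: "sublinear_on V q" if "q \<in> C" for q
        using that CS unfolding S_def by auto
      have "u (\<lambda>x. g x + h x) \<le> u g + u h" if g: "g \<in> V" and h: "h \<in> V" for g h
      proof -
        have gh: "(\<lambda>x. g x + h x) \<in> V" by (rule function_subspace_add[OF V g h])
        have *: "u (\<lambda>x. g x + h x) \<le> q1 g + q2 h" if q: "q1 \<in> C" "q2 \<in> C" for q1 q2
        proof -
          obtain r where r: "r \<in> C" "r \<le> q1" "r \<le> q2" using ch[OF q] q by blast
          have "u (\<lambda>x. g x + h x) \<le> r (\<lambda>x. g x + h x)" by (rule lower[OF r(1) gh])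
          also have "\<dots> \<le> r g + r h" by (rule sublinear_on_add[OF sub[OF r(1)] g h])
          also have "\<dots> \<le> q1 g + q2 h" using r by (auto simp: le_fun_def intro: add_mono)
          finally show ?thesis .
        qed
        have "u (\<lambda>x. g x + h x) - u h \<le> u g"
        proof (rule greatest[OF g])
          fix q1 assume "q1 \<in> C"
          have "u (\<lambda>x. g x + h x) - q1 g \<le> u h"
            by (rule greatest[OF h]) (use *[OF \<open>q1 \<in> C\<close>] in \<open>simp add: algebra_simps\<close>)
          then show "u (\<lambda>x. g x + h x) - u h \<le> q1 g" by simp
        qed
        then show ?thesis by simp
      qed
      moreover have "u (\<lambda>x. c * h x) \<le> c * u h" if h: "h \<in> V" and c: "c > 0" for h c
      proof -
        have chV: "(\<lambda>x. c * h x) \<in> V" by (rule function_subspace_scale[OF V h])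
        have "u (\<lambda>x. c * h x) / c \<le> u h"
        proof (rule greatest[OF h])
          fix q assume "q \<in> C"
          then have "u (\<lambda>x. c * h x) \<le> c * q h"
            using lower[OF _ chV] sublinear_on_scale_le[OF sub h c] by (meson order_trans)
          then show "u (\<lambda>x. c * h x) / c \<le> q h" using c by (simp add: field_simps)
        qed
        then show ?thesis using c by (simp add: field_simps)
      qed
      ultimately have "sublinear_on V u" unfolding sublinear_on_def by blast
      moreover have "\<forall>h\<in>V. u h \<le> p h"
      proof
        fix h assume h: "h \<in> V"
        obtain q where q: "q \<in> C" using ne by blast
        then have "q h \<le> p h" using CS h unfolding S_def by auto
        then show "u h \<le> p h" using lower[OF q h] by simp
      qed
      moreover have "u h = 0" if "h \<notin> V" for h using that unfolding u_def by simp
      ultimately have "u \<in> S" unfolding S_def by simp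
      moreover have "u \<le> q" if "q \<in> C" for q
      proof (rule le_funI)
        fix h show "u h \<le> q h"
          using lower[OF that] that CS unfolding S_def u_def by (cases "h \<in> V") auto
      qed
      ultimately show ?thesis by blast
    qed
  qed
  then obtain q where q: "q \<in> S" and qmin: "\<And>r. r \<in> S \<Longrightarrow> r \<le> q \<Longrightarrow> r = q" by blast
  show thesis
  proof (rule that[of q])
    show "sublinear_on V q" "\<And>h. h \<in> V \<Longrightarrow> q h \<le> p h" using q unfolding S_def by auto
    fix r h assume r: "sublinear_on V r" "\<And>k. k \<in> V \<Longrightarrow> r k \<le> q k" and h: "h \<in> V"
    have "cut r \<in> S" using r q by (intro cut) (auto simp: S_def intro: order_trans)
    moreover have "cut r \<le> q" using r q by (auto simp: cut_def S_def le_fun_def)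
    ultimately have "cut r = q" by (rule qmin)
    then show "r h = q h" using h unfolding cut_def by (metis (mono_tags))
  qed
qed

text \<open>Starting from \<open>p\<close> lowered in the direction \<open>y\<close>, every linear functional below it takes at
  \<open>- y\<close> a value of at most \<open>- p y\<close>, which forces equality at \<open>y\<close>.\<close>
theorem Hahn_Banach_sublinear:
  fixes p :: "('b \<Rightarrow> real) \<Rightarrow> real"
  assumes V: "function_subspace V" and p: "sublinear_on V p" and y: "y \<in> V"
  obtains F where "linear_functional_on V F" "\<And>h. h \<in> V \<Longrightarrow> F h \<le> p h" "F y = p y"
proof -
  obtain F where F: "sublinear_on V F" and Fle: "\<And>h. h \<in> V \<Longrightarrow> F h \<le> lowered p y h"
    and min: "\<And>r h. sublinear_on V r \<Longrightarrow> (\<And>k. k \<in> V \<Longrightarrow> r k \<le> F k) \<Longrightarrow> h \<in> V \<Longrightarrow> r h = F h"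
    using ex_minimal_sublinear[OF V sublinear_on_lowered[OF V p y]] by blast
  have lin: "linear_functional_on V F"
    using linear_functional_on_minimal_sublinear[OF V F] min by blast
  have le: "F h \<le> p h" if "h \<in> V" for h
    using Fle[OF that] lowered_le[OF V p y that, of 0] by simp
  have my: "(\<lambda>x. - y x) \<in> V" by (rule function_subspace_uminus[OF V y])
  have "p (\<lambda>x. 0) = 0" using sublinear_on_scale[OF V p y, of 0] by simp
  then have "F (\<lambda>x. - y x) \<le> - p y"
    using Fle[OF my] lowered_le[OF V p y my, of 1] by simp
  moreover have "F (\<lambda>x. (-1) * y x) = - 1 * F y"
    using lin y by (simp only: linear_functional_on_def)
  ultimately have "F y = p y" using le[OF y] by simp
  with lin le show thesis by (rule that)
qed

section \<open>Representing positive functionals by measures\<close>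

lemma space_nonneg_borel_measure: "\<mu> \<in> nonneg_borel_measures K \<Longrightarrow> space \<mu> = K"
  using sets_eq_imp_space_eq[of \<mu> "restrict_space borel K"]
  by (simp add: nonneg_borel_measures_def space_restrict_space)

lemma integrable_continuous_nonneg_borel_measure:
  fixes h :: "'a::t2_space \<Rightarrow> real"
  assumes \<mu>: "\<mu> \<in> nonneg_borel_measures K" and K: "compact K" and h: "continuous_on K h"
  shows "integrable \<mu> h"
proof -
  have \<mu>': "finite_measure \<mu>" "sets \<mu> = sets (restrict_space borel K)"
    using \<mu> by (simp_all add: nonneg_borel_measures_def)
  obtain B where B: "\<And>x. x \<in> K \<Longrightarrow> norm (h x) \<le> B"
    using compact_imp_bounded[OF compact_continuous_image[OF h K]] unfolding bounded_iff by auto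
  have meas: "h \<in> borel_measurable \<mu>"
    using borel_measurable_continuous_on_restrict[OF h]
    by (simp add: measurable_cong_sets[OF \<mu>'(2) refl])
  have "AE x in \<mu>. norm (h x) \<le> B"
    using B by (intro AE_I2) (simp add: space_nonneg_borel_measure[OF \<mu>])
  then show ?thesis
    using meas by (rule finite_measure.integrable_const_bound[OF \<mu>'(1)])
qed

text \<open>The functional takes functions on the whole space, but the axioms speak only about their
  restrictions to \<open>K\<close>; positivity makes its value depend on that restriction alone.\<close>
locale positive_functional =
  fixes K :: "'a::euclidean_space set" and F :: "('a \<Rightarrow> real) \<Rightarrow> real"
  assumes compact_domain: "compact K"
    and add: "\<And>g h. continuous_on K g \<Longrightarrow> continuous_on K h \<Longrightarrow> F (\<lambda>x. g x + h x) = F g + F h"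
    and scale: "\<And>h c. continuous_on K h \<Longrightarrow> F (\<lambda>x. c * h x) = c * F h"
    and nonneg: "\<And>h. continuous_on K h \<Longrightarrow> (\<And>x. x \<in> K \<Longrightarrow> 0 \<le> h x) \<Longrightarrow> 0 \<le> F h"
begin

lemma diff:
  assumes "continuous_on K g" "continuous_on K h"
  shows "F (\<lambda>x. g x - h x) = F g - F h"
  using add[of g "\<lambda>x. - 1 * h x"] scale[of h "-1"] assms by (simp add: continuous_intros)

lemma mono:
  assumes "continuous_on K g" "continuous_on K h" "\<And>x. x \<in> K \<Longrightarrow> g x \<le> h x"
  shows "F g \<le> F h"
  using nonneg[of "\<lambda>x. h x - g x"] diff[of h g] assms by (simp add: continuous_intros)

lemma sum:
  assumes "\<And>i. i < (n::nat) \<Longrightarrow> continuous_on K (h i)"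
  shows "F (\<lambda>x. \<Sum>i<n. h i x) = (\<Sum>i<n. F (h i))"
  using assms
proof (induction n)
  case 0
  show ?case using scale[of "\<lambda>x. 1" 0] by simp
next
  case (Suc n)
  have "continuous_on K (\<lambda>x. \<Sum>i<n. h i x)" using Suc.prems by (intro continuous_intros) simp
  then show ?case using Suc add[of "\<lambda>x. \<Sum>i<n. h i x" "h n"] by simp
qed

definition mass :: real where "mass = F (\<lambda>x. 1)"

lemma const: "F (\<lambda>x. c) = c * mass"
  using scale[of "\<lambda>x. 1" c] by (simp add: mass_def)

lemma mass_nonneg: "0 \<le> mass"
  unfolding mass_def by (rule nonneg) auto

text \<open>The three pointwise conditions say that \<open>h\<close> lies between 0 and the indicator of \<open>A\<close>
  on \<open>K\<close>.\<close>
definition under :: "'a set \<Rightarrow> ('a \<Rightarrow> real) set" where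
  "under A = {h. continuous_on K h \<and> (\<forall>x\<in>K. 0 \<le> h x \<and> h x \<le> 1 \<and> (x \<notin> A \<longrightarrow> h x = 0))}"

text \<open>The inner approximation of the indicator of \<open>A\<close>; the measure sought must have this value
  on open sets.\<close>
definition content :: "'a set \<Rightarrow> real" where
  "content A = (SUP h\<in>under A. F h)"

lemma under_mono: "A \<inter> K \<subseteq> B \<Longrightarrow> under A \<subseteq> under B"
  unfolding under_def by auto

lemma zero_in_under: "(\<lambda>x. 0) \<in> under A"
  unfolding under_def by simp

lemma under_bounds: "h \<in> under A \<Longrightarrow> x \<in> K \<Longrightarrow> 0 \<le> h x \<and> h x \<le> 1"
  unfolding under_def by auto

lemma under_continuous: "h \<in> under A \<Longrightarrow> continuous_on K h"
  unfolding under_def by simp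

lemma F_le_mass: "h \<in> under A \<Longrightarrow> F h \<le> mass"
  unfolding mass_def by (rule mono) (simp_all add: under_bounds under_continuous)

lemma content_upper: "h \<in> under A \<Longrightarrow> F h \<le> content A"
  unfolding content_def by (rule cSUP_upper) (auto intro: bdd_aboveI2 F_le_mass)

lemma content_least: "(\<And>h. h \<in> under A \<Longrightarrow> F h \<le> b) \<Longrightarrow> content A \<le> b"
  unfolding content_def by (rule cSUP_least) (use zero_in_under in blast)+

lemma content_nonneg: "0 \<le> content A"
  using content_upper[OF zero_in_under, of A] const[of 0] by simp

lemma content_le_mass: "content A \<le> mass"
  by (rule content_least) (rule F_le_mass)

lemma content_eq_mass:
  assumes "K \<subseteq> A"
  shows "content A = mass"
proof (rule antisym[OF content_le_mass])
  have "(\<lambda>x. 1) \<in> under A" using assms by (auto simp: under_def)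
  then show "mass \<le> content A" unfolding mass_def by (rule content_upper)
qed

lemma content_mono: "A \<inter> K \<subseteq> B \<Longrightarrow> content A \<le> content B"
  by (rule content_least, rule content_upper) (use under_mono in blast)

lemma content_empty: "content {} = 0"
proof (rule antisym[OF content_least content_nonneg])
  fix h assume "h \<in> under {}"
  then have "F h \<le> F (\<lambda>x. 0)" by (intro mono) (simp_all add: under_def)
  then show "F h \<le> 0" using const[of 0] by simp
qed

text \<open>It suffices to test the content with functions supported in compact subsets of \<open>A\<close>:
  replacing \<open>h\<close> by its excess over \<open>\<epsilon>\<close> costs at most \<open>\<epsilon>\<close> times the total mass, and that
  excess vanishes off the compact set where \<open>h\<close> is at least \<open>\<epsilon>\<close>. Compactness is the
  source of countable subadditivity.\<close>
lemma content_least_compact: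
  assumes le: "\<And>C g. compact C \<Longrightarrow> C \<subseteq> K \<inter> A \<Longrightarrow> g \<in> under C \<Longrightarrow> F g \<le> b"
  shows "content A \<le> b"
proof (rule content_least)
  fix h assume h: "h \<in> under A"
  then have cont: "continuous_on K h" by (simp add: under_def)
  have cut: "F h \<le> b + \<epsilon> * mass" if "\<epsilon> > 0" for \<epsilon>
  proof -
    define C where "C = K \<inter> h -` {\<epsilon>..}"
    define g where "g = (\<lambda>x. max (h x - \<epsilon>) 0)"
    have "closed C" unfolding C_def
      using cont compact_domain by (intro continuous_closed_preimage) (auto intro: compact_imp_closed)
    then have "compact C" using compact_domain unfolding C_def
      by (metis Int_absorb1 compact_Int_closed inf.cobounded1)
    moreover have "C \<subseteq> K \<inter> A"
      using h that unfolding C_def under_def by force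
    moreover have contg: "continuous_on K g" unfolding g_def using cont by (intro continuous_intros)
    moreover have "g \<in> under C"
      unfolding under_def
    proof (safe intro!: contg)
      fix x assume x: "x \<in> K"
      show "0 \<le> g x" "g x \<le> 1" using under_bounds[OF h x] that by (auto simp: g_def)
      show "g x = 0" if "x \<notin> C" using x that by (auto simp: g_def C_def)
    qed
    ultimately have "F g \<le> b" using le by blast
    moreover have "F h \<le> F (\<lambda>x. \<epsilon> + g x)"
      using cont contg by (intro mono continuous_intros) (auto simp: g_def)
    moreover have "F (\<lambda>x. \<epsilon> + g x) = \<epsilon> * mass + F g"
      using add[of "\<lambda>x. \<epsilon>" g] contg const by simp
    ultimately show ?thesis by simp
  qed
  show "F h \<le> b"
  proof (rule field_le_epsilon)
    fix e :: real assume e: "e > 0"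
    have "e / (mass + 1) * mass \<le> e" using e mass_nonneg by (simp add: field_simps)
    moreover have "F h \<le> b + e / (mass + 1) * mass"
      by (rule cut) (use e mass_nonneg in simp)
    ultimately show "F h \<le> b + e" by simp
  qed
qed

text \<open>A function supported in a compact subset of \<open>U \<union> V\<close> is cut into two by a Urysohn function
  that separates the part outside \<open>V\<close> from the part outside \<open>U\<close>.\<close>
lemma content_Un:
  assumes U: "open U" and V: "open V"
  shows "content (U \<union> V) \<le> content U + content V"
proof (rule content_least_compact)
  fix C g assume C: "compact C" "C \<subseteq> K \<inter> (U \<union> V)" and g: "g \<in> under C"
  have cl: "closed (C - V)" "closed (C - U)"
    using C U V by (auto intro: closed_Diff compact_imp_closed)
  have disj: "(C - V) \<inter> (C - U) = {}" using C by auto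
  obtain \<rho> :: "'a \<Rightarrow> real" where \<rho>: "continuous_on UNIV \<rho>"
    "\<And>x. \<rho> x \<in> closed_segment 1 0" "\<And>x. x \<in> C - V \<Longrightarrow> \<rho> x = 1" "\<And>x. x \<in> C - U \<Longrightarrow> \<rho> x = 0"
    by (rule Urysohn[OF cl disj, where a = "1::real" and b = 0]) blast
  have \<rho>01: "0 \<le> \<rho> x" "\<rho> x \<le> 1" for x
    using \<rho>(2)[of x] by (auto simp: closed_segment_eq_real_ivl)
  have cont: "continuous_on K \<rho>" "continuous_on K g"
    using \<rho>(1) g by (auto simp: under_def intro: continuous_on_subset)
  have g0: "g x = 0" if "x \<in> K" "x \<notin> C" for x
    using g that unfolding under_def by auto
  have bnd: "0 \<le> g x * \<sigma>" "g x * \<sigma> \<le> 1" if "x \<in> K" "0 \<le> \<sigma>" "\<sigma> \<le> 1" for x \<sigma>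
    using under_bounds[OF g that(1)] that by (auto intro: mult_le_one)
  have "(\<lambda>x. g x * \<rho> x) \<in> under U"
    unfolding under_def
  proof (safe intro!: continuous_intros cont)
    fix x assume "x \<in> K"
    show "0 \<le> g x * \<rho> x" "g x * \<rho> x \<le> 1" using bnd[OF \<open>x \<in> K\<close> \<rho>01[of x]] by auto
    show "g x * \<rho> x = 0" if "x \<notin> U" using g0[OF \<open>x \<in> K\<close>] \<rho>(4)[of x] that by auto
  qed
  moreover have "(\<lambda>x. g x * (1 - \<rho> x)) \<in> under V"
    unfolding under_def
  proof (safe intro!: continuous_intros cont)
    fix x assume "x \<in> K"
    show "0 \<le> g x * (1 - \<rho> x)" "g x * (1 - \<rho> x) \<le> 1"
      using bnd[OF \<open>x \<in> K\<close>, of "1 - \<rho> x"] \<rho>01[of x] by auto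
    show "g x * (1 - \<rho> x) = 0" if "x \<notin> V"
      using g0[OF \<open>x \<in> K\<close>] \<rho>(3)[of x] that by auto
  qed
  moreover have "F g = F (\<lambda>x. g x * \<rho> x) + F (\<lambda>x. g x * (1 - \<rho> x))"
    using add[of "\<lambda>x. g x * \<rho> x" "\<lambda>x. g x * (1 - \<rho> x)"] cont
    by (simp add: continuous_intros algebra_simps)
  ultimately show "F g \<le> content U + content V"
    using content_upper by (simp add: add_mono)
qed

lemma content_finite_UN:
  assumes "\<And>i. open (U i)"
  shows "content (\<Union>i<n. U i) \<le> (\<Sum>i<n::nat. content (U i))"
proof (induction n)
  case 0
  show ?case by (simp add: content_empty)
next
  case (Suc n)
  have "content ((\<Union>i<n. U i) \<union> U n) \<le> content (\<Union>i<n. U i) + content (U n)"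
    using assms by (intro content_Un) auto
  moreover have "(\<Union>i<Suc n. U i) = (\<Union>i<n. U i) \<union> U n" by (auto simp: less_Suc_eq)
  ultimately show ?case using Suc by simp
qed

text \<open>A compact support meets only finitely many of the sets, so the countable case reduces to the
  finite one.\<close>
lemma content_UN:
  assumes U: "\<And>i::nat. open (U i)"
  shows "ennreal (content (\<Union>i. U i)) \<le> (\<Sum>i. ennreal (content (U i)))"
proof (cases "\<Sum>i. ennreal (content (U i))")
  case (real r)
  have "content (\<Union>i. U i) \<le> r"
  proof (rule content_least_compact)
    fix C g assume C: "compact C" "C \<subseteq> K \<inter> (\<Union>i. U i)" and g: "g \<in> under C"
    obtain I where I: "finite I" "C \<subseteq> (\<Union>i\<in>I. U i)"
      using compactE_image[OF C(1), of UNIV U] C(2) U by auto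
    obtain n where n: "I \<subseteq> {..<n}" using I(1) finite_nat_iff_bounded by blast
    have "F g \<le> content (\<Union>i<n. U i)"
      using g I n under_mono[of C "\<Union>i<n. U i"] by (intro content_upper) blast
    also have "\<dots> \<le> (\<Sum>i<n. content (U i))" by (rule content_finite_UN[OF U])
    also have "\<dots> \<le> r"
    proof -
      have "ennreal (\<Sum>i<n. content (U i)) = (\<Sum>i<n. ennreal (content (U i)))"
        by (simp add: content_nonneg)
      also have "\<dots> \<le> (\<Sum>i. ennreal (content (U i)))" by (rule sum_le_suminf) auto
      finally show ?thesis using real by simp
    qed
    finally show "F g \<le> r" .
  qed
  then show ?thesis using real by (simp add: ennreal_leI)
qed simp

definition outer :: "'a set \<Rightarrow> ennreal" where
  "outer A = (INF U\<in>{U. open U \<and> A \<subseteq> U}. ennreal (content U))"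

lemma outer_le: "open U \<Longrightarrow> A \<subseteq> U \<Longrightarrow> outer A \<le> ennreal (content U)"
  unfolding outer_def by (rule INF_lower) simp

text \<open>The content of an open set sees only its trace on \<open>K\<close>, hence so does the outer measure;
  this is why the outer measure, built on the whole space, can be restricted to \<open>K\<close> without
  losing mass.\<close>
lemma outer_Int_domain: "open U \<Longrightarrow> outer (U \<inter> K) = ennreal (content U)"
  by (intro antisym outer_le)
    (auto simp: outer_def intro!: INF_greatest ennreal_leI content_mono)

lemma outer_open: "open U \<Longrightarrow> outer U = ennreal (content U)"
  by (intro antisym outer_le)
    (auto simp: outer_def intro!: INF_greatest ennreal_leI content_mono)

lemma outer_mono: "A \<subseteq> B \<Longrightarrow> outer A \<le> outer B"
  unfolding outer_def by (rule INF_superset_mono) auto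

lemma outer_close:
  assumes "e > 0"
  obtains U where "open U" "A \<subseteq> U" "ennreal (content U) \<le> outer A + ennreal e"
proof -
  have "outer A \<le> ennreal mass" using outer_le[of UNIV A] content_eq_mass[of UNIV] by simp
  then have "outer A \<noteq> top" by (auto simp: top_unique)
  then have "outer A < outer A + ennreal e" using assms by simp
  then show thesis using that unfolding outer_def INF_less_iff by (auto intro: less_imp_le)
qed

lemma outer_measure_space_outer: "outer_measure_space UNIV outer"
proof -
  have "outer (\<Union>i. A i) \<le> (\<Sum>i. outer (A i))" for A :: "nat \<Rightarrow> 'a set"
  proof (rule ennreal_le_epsilon)
    fix e :: real assume e: "e > 0"
    have "\<exists>U. open U \<and> A i \<subseteq> U \<and> ennreal (content U) \<le> outer (A i) + ennreal (e * (1/2) ^ Suc i)" for i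
    proof -
      have "e * (1/2) ^ Suc i > 0" using e by simp
      then obtain U where "open U" "A i \<subseteq> U"
          "ennreal (content U) \<le> outer (A i) + ennreal (e * (1/2) ^ Suc i)"
        by (rule outer_close)
      then show ?thesis by blast
    qed
    then obtain U where U: "\<And>i. open (U i)" "\<And>i. A i \<subseteq> U i"
      "\<And>i. ennreal (content (U i)) \<le> outer (A i) + ennreal (e * (1/2) ^ Suc i)"
      by metis
    have "outer (\<Union>i. A i) \<le> ennreal (content (\<Union>i. U i))"
      using U by (intro outer_le) auto
    also have "\<dots> \<le> (\<Sum>i. ennreal (content (U i)))" by (rule content_UN[OF U(1)])
    also have "\<dots> \<le> (\<Sum>i. outer (A i) + ennreal (e * (1/2) ^ Suc i))"
      by (intro suminf_le U) auto
    also have "\<dots> = (\<Sum>i. outer (A i)) + (\<Sum>i. ennreal (e * (1/2) ^ Suc i))"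
      by (intro suminf_add[symmetric]) auto
    also have "(\<Sum>i. ennreal (e * (1/2) ^ Suc i)) = ennreal e"
      using e sums_mult[OF power_half_series, of e] by (intro suminf_ennreal_eq) auto
    finally show "outer (\<Union>i. A i) \<le> (\<Sum>i. outer (A i)) + ennreal e" .
  qed
  moreover have "outer {} = 0" using outer_open[of "{}"] content_empty by simp
  ultimately show ?thesis
    unfolding outer_measure_space_def positive_def increasing_def countably_subadditive_def
    using outer_mono by auto
qed

lemma outer_Un_disjoint:
  assumes "A \<inter> B = {}"
  shows "outer (A \<union> B) \<le> outer A + outer B"
proof -
  have "positive UNIV outer" "countably_subadditive UNIV outer"
    using outer_measure_space_outer by (simp_all add: outer_measure_space_def)
  moreover have "ring_of_sets (UNIV :: 'a set) UNIV"
    by (metis Pow_UNIV algebra.axioms(1) algebra_Pow)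
  ultimately have "subadditive UNIV outer"
    by (metis ring_of_sets.countably_subadditive_subadditive)
  then show ?thesis using assms by (simp add: subadditive_def)
qed

text \<open>The nontrivial half of Caratheodory's criterion for the open set \<open>U\<close>, tested on an open
  set \<open>V\<close>. A function \<open>g\<close> supported in a compact \<open>C \<subseteq> U \<inter> V\<close> and a function below the
  indicator of \<open>V - C\<close>, which is open and contains \<open>V - U\<close>, add up to a function below the
  indicator of \<open>V\<close>.\<close>
lemma outer_split_open:
  assumes U: "open U" and V: "open V"
  shows "outer (U \<inter> V) + outer (V - U) \<le> ennreal (content V)"
proof -
  have "outer (V - U) \<le> ennreal (content V)" using V by (intro outer_le) auto
  then obtain r where r: "outer (V - U) = ennreal r" "0 \<le> r" "r \<le> content V"
    using content_nonneg[of V] by (cases "outer (V - U)") (auto simp: top_unique)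
  have "content (U \<inter> V) \<le> content V - r"
  proof (rule content_least_compact)
    fix C g assume C: "compact C" "C \<subseteq> K \<inter> (U \<inter> V)" and g: "g \<in> under C"
    have W: "open (V - C)" using V C by (auto intro: open_Diff compact_imp_closed)
    have "outer (V - U) \<le> ennreal (content (V - C))" using C by (intro outer_le W) auto
    then have "r \<le> content (V - C)" using r content_nonneg by simp
    also have "content (V - C) \<le> content V - F g"
    proof (rule content_least)
      fix h assume h: "h \<in> under (V - C)"
      have "(\<lambda>x. g x + h x) \<in> under V"
        unfolding under_def
      proof (safe intro!: continuous_intros)
        fix x assume x: "x \<in> K"
        have bnd: "0 \<le> g x" "0 \<le> h x" "g x \<le> 1" "h x \<le> 1" using g h x by (auto simp: under_def)
        have g0: "x \<notin> C \<Longrightarrow> g x = 0" using g x by (simp add: under_def)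
        have h0: "x \<notin> V - C \<Longrightarrow> h x = 0" using h x by (simp add: under_def)
        show "0 \<le> g x + h x" using bnd by simp
        show "g x + h x \<le> 1" using bnd g0 h0 by (cases "x \<in> C") auto
        show "g x + h x = 0" if "x \<notin> V" using that g0 h0 C by auto
      qed (use g h in \<open>auto simp: under_def\<close>)
      then have "F (\<lambda>x. g x + h x) \<le> content V" by (rule content_upper)
      moreover have "F (\<lambda>x. g x + h x) = F g + F h"
        using g h by (intro add) (auto simp: under_def)
      ultimately show "F h \<le> content V - F g" by simp
    qed
    finally show "F g \<le> content V - r" by simp
  qed
  then have "ennreal (content (U \<inter> V)) + ennreal r \<le> ennreal (content V)"
    using r content_nonneg by (simp add: ennreal_plus[symmetric] ennreal_leI del: ennreal_plus)
  then show ?thesis using outer_open[of "U \<inter> V"] U V r by (simp add: open_Int)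
qed

lemma open_in_lambda_system:
  assumes U: "open U"
  shows "U \<in> lambda_system UNIV UNIV outer"
proof -
  have "outer (U \<inter> A) + outer ((UNIV - U) \<inter> A) = outer A" for A
  proof (rule antisym)
    show "outer (U \<inter> A) + outer ((UNIV - U) \<inter> A) \<le> outer A"
      unfolding outer_def[of A]
    proof (rule INF_greatest, clarify)
      fix V assume V: "open V" "A \<subseteq> V"
      have "outer (U \<inter> A) + outer ((UNIV - U) \<inter> A) \<le> outer (U \<inter> V) + outer (V - U)"
        using V by (intro add_mono outer_mono) auto
      also have "\<dots> \<le> ennreal (content V)" by (rule outer_split_open[OF U V(1)])
      finally show "outer (U \<inter> A) + outer ((UNIV - U) \<inter> A) \<le> ennreal (content V)" .
    qed
    have "outer ((U \<inter> A) \<union> ((UNIV - U) \<inter> A)) \<le> outer (U \<inter> A) + outer ((UNIV - U) \<inter> A)"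
      by (rule outer_Un_disjoint) auto
    moreover have "(U \<inter> A) \<union> ((UNIV - U) \<inter> A) = A" by auto
    ultimately show "outer A \<le> outer (U \<inter> A) + outer ((UNIV - U) \<inter> A)" by simp
  qed
  then show ?thesis unfolding lambda_system_def by auto
qed

definition borel_extension :: "'a measure" where
  "borel_extension = measure_of UNIV (sets borel) outer"

lemma sets_borel_extension [simp, measurable_cong]: "sets borel_extension = sets borel"
  unfolding borel_extension_def using sets.sigma_sets_eq[of "borel :: 'a measure"]
  by (simp add: sets_measure_of_conv)

lemma space_borel_extension [simp]: "space borel_extension = UNIV"
  unfolding borel_extension_def by (simp add: space_measure_of_conv)

lemma emeasure_borel_extension:
  assumes "A \<in> sets borel"
  shows "emeasure borel_extension A = outer A"
proof -
  have L: "measure_space UNIV (lambda_system UNIV UNIV outer) outer"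
    using sigma_algebra.caratheodory_lemma[OF sigma_algebra_Pow, of "UNIV :: 'a set" outer]
      outer_measure_space_outer by simp
  have "sets borel \<subseteq> lambda_system UNIV UNIV outer"
    using sigma_algebra.sigma_sets_subset[of UNIV "lambda_system UNIV UNIV outer" "{S. open S}"]
      L open_in_lambda_system
    by (auto simp: borel_def measure_space_def)
  then have "measure_space UNIV (sets borel) outer"
    using L sets.sigma_algebra_axioms[of "borel :: 'a measure"] by (intro measure_down[OF L]) auto
  then show ?thesis
    using assms unfolding borel_extension_def measure_space_def
    by (intro emeasure_measure_of_sigma) auto
qed

definition representing_measure :: "'a measure" where
  "representing_measure = restrict_space borel_extension K"

lemma K_borel: "K \<in> sets borel"
  using compact_domain by (auto intro: borel_closed compact_imp_closed)

lemma sets_representing_measure: "sets representing_measure = sets (restrict_space borel K)"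
  unfolding representing_measure_def by (auto simp: sets_restrict_space)

lemma space_representing_measure: "space representing_measure = K"
  unfolding representing_measure_def by (simp add: space_restrict_space)

lemma emeasure_representing_measure_open:
  assumes U: "open U"
  shows "emeasure representing_measure (U \<inter> K) = ennreal (content U)"
proof -
  have "emeasure representing_measure (U \<inter> K) = emeasure borel_extension (U \<inter> K)"
    unfolding representing_measure_def using K_borel by (intro emeasure_restrict_space) auto
  also have "\<dots> = outer (U \<inter> K)" using U K_borel by (intro emeasure_borel_extension) auto
  finally show ?thesis using outer_Int_domain[OF U] by simp
qed

lemma emeasure_representing_measure_domain: "emeasure representing_measure K = ennreal mass"
  using emeasure_representing_measure_open[of UNIV] content_eq_mass[of UNIV] by simp

lemma finite_measure_representing_measure: "finite_measure representing_measure"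
  by (rule finite_measureI)
    (simp add: space_representing_measure emeasure_representing_measure_domain)

lemma representing_measure_in: "representing_measure \<in> nonneg_borel_measures K"
  by (simp add: nonneg_borel_measures_def finite_measure_representing_measure
      sets_representing_measure)

lemma integrable_representing_measure:
  fixes h :: "'a \<Rightarrow> real"
  assumes "continuous_on K h"
  shows "integrable representing_measure h"
  by (rule integrable_continuous_nonneg_borel_measure[OF representing_measure_in compact_domain assms])

lemma superlevel_open:
  fixes a :: real
  assumes h: "continuous_on K h"
  obtains U where "open U" "U \<inter> K = {x\<in>K. a < h x}"
proof -
  obtain U where "open U" "U \<inter> K = h -` {a<..} \<inter> K"
    using h open_greaterThan continuous_on_open_invariant by metis
  then show thesis by (intro that[of U]) auto
qed

text \<open>Cut \<open>h\<close> into \<open>N\<close> horizontal layers of height \<open>1 / N\<close>. The layer above level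
  \<open>a i\<close> is \<open>1 / N\<close> times a function between the indicators of two consecutive superlevel sets,
  so its value under \<open>F\<close> is bounded above through the larger set and its integral below through
  the smaller one. The two sums telescope to a difference of at most \<open>mass / N\<close>.\<close>
lemma functional_le_integral:
  assumes h: "continuous_on K h" and h01: "\<And>x. x \<in> K \<Longrightarrow> 0 \<le> h x \<and> h x \<le> 1"
  shows "F h \<le> (LINT x|representing_measure. h x)"
proof -
  let ?M = representing_measure
  interpret finite_measure ?M by (rule finite_measure_representing_measure)
  have layers: "F h \<le> (LINT x|?M. h x) + mass / real N" if N: "N > 0" for N :: nat
  proof -
    define a where "a i = real i / real N" for i
    define S where "S i = {x\<in>K. a i < h x}" for i
    define k where "k i x = min (h x) (a (Suc i)) - min (h x) (a i)" for i x
    have a: "a 0 = 0" "a N = 1" "a (Suc i) = a i + 1 / real N" for i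
      using N by (auto simp: a_def field_simps)
    have step: "0 < 1 / real N" using N by simp
    have inc: "a i \<le> a (Suc i)" for i using a(3)[of i] step by linarith
    have contk: "continuous_on K (k i)" for i
      unfolding k_def using h by (intro continuous_intros)
    have hk: "h x = (\<Sum>i<N. k i x)" if "x \<in> K" for x
      using sum_lessThan_telescope[of "\<lambda>i. min (h x) (a i)" N] a h01[OF that] unfolding k_def by simp
    have S: "S i \<in> sets ?M" "measure ?M (S i) = content (S i)" for i
    proof -
      obtain U where U: "open U" "U \<inter> K = S i" using superlevel_open[OF h, of "a i"] unfolding S_def by metis
      have "K \<inter> U \<in> sets (restrict_space borel K)" using U(1) by (auto simp: sets_restrict_space)
      then show "S i \<in> sets ?M" using U by (simp add: sets_representing_measure Int_commute)
      have "content U = content (S i)" using U by (intro antisym content_mono) auto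
      then show "measure ?M (S i) = content (S i)"
        using emeasure_representing_measure_open[OF U(1)] U(2) content_nonneg
        by (simp add: measure_def)
    qed
    have up: "F (k i) \<le> measure ?M (S i) / real N" for i
    proof -
      have "(\<lambda>x. real N * k i x) \<in> under (S i)"
        unfolding under_def
      proof (safe intro!: continuous_intros contk)
        fix x assume x: "x \<in> K"
        have "0 \<le> k i x" "k i x \<le> 1 / real N"
          using a(3)[of i] step unfolding k_def by linarith+
        then show "0 \<le> real N * k i x" "real N * k i x \<le> 1"
          using N by (auto simp: field_simps)
        show "real N * k i x = 0" if "x \<notin> S i"
          using x that inc[of i] by (simp add: k_def S_def)
      qed
      then have "F (\<lambda>x. real N * k i x) \<le> content (S i)" by (rule content_upper)
      then show ?thesis using scale[OF contk, of "real N" i] S(2)[of i] N by (simp add: field_simps)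
    qed
    have low: "measure ?M (S (Suc i)) / real N \<le> (LINT x|?M. k i x)" for i
    proof -
      have "measure ?M (S (Suc i)) / real N = (LINT x|?M. indicator (S (Suc i)) x / real N)"
        using S(1)[of "Suc i"] sets.sets_into_space[OF S(1)[of "Suc i"]] by (simp add: Int_absorb2)
      also have "\<dots> \<le> (LINT x|?M. k i x)"
      proof (rule integral_mono)
        show "integrable ?M (\<lambda>x. indicator (S (Suc i)) x / real N :: real)"
          using S(1)[of "Suc i"] by (intro integrable_divide integrable_real_indicator) (auto simp: less_top[symmetric])
        show "integrable ?M (k i)" by (rule integrable_representing_measure[OF contk])
        fix x
        show "indicator (S (Suc i)) x / real N \<le> k i x"
        proof (cases "x \<in> S (Suc i)")
          case True
          then show ?thesis using a(3)[of i] inc[of i] by (simp add: k_def S_def)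
        next
          case False
          have "0 \<le> k i x" using inc[of i] unfolding k_def by linarith
          with False show ?thesis by simp
        qed
      qed
      finally show ?thesis .
    qed
    have "F h = F (\<lambda>x. \<Sum>i<N. k i x)"
      using hk h contk by (intro antisym mono continuous_intros) auto
    also have "\<dots> = (\<Sum>i<N. F (k i))" by (rule sum) (rule contk)
    also have "\<dots> \<le> (\<Sum>i<N. measure ?M (S i) / real N)" by (intro sum_mono up)
    also have "\<dots> = (\<Sum>i<N. measure ?M (S (Suc i)) / real N)
        + (measure ?M (S 0) / real N - measure ?M (S N) / real N)"
      using sum_lessThan_telescope'[of "\<lambda>i. measure ?M (S i) / real N" N]
      by (simp add: sum_subtractf)
    also have "\<dots> \<le> (\<Sum>i<N. LINT x|?M. k i x) + mass / real N"
    proof (rule add_mono)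
      have "measure ?M (S 0) / real N \<le> mass / real N"
        using S(2)[of 0] content_le_mass by (simp add: divide_right_mono)
      then show "measure ?M (S 0) / real N - measure ?M (S N) / real N \<le> mass / real N"
        by (rule order_trans[rotated]) simp
    qed (intro sum_mono low)
    also have "(\<Sum>i<N. LINT x|?M. k i x) = (LINT x|?M. h x)"
    proof -
      have "(LINT x|?M. h x) = (LINT x|?M. (\<Sum>i<N. k i x))"
        using hk by (intro Bochner_Integration.integral_cong) (auto simp: space_representing_measure)
      also have "\<dots> = (\<Sum>i<N. LINT x|?M. k i x)"
        by (intro Bochner_Integration.integral_sum integrable_representing_measure contk)
      finally show ?thesis by simp
    qed
    finally show ?thesis .
  qed
  have "(\<lambda>N. (LINT x|?M. h x) + mass / real N) \<longlonglongrightarrow> (LINT x|?M. h x) + 0"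
    by (intro tendsto_intros lim_const_over_n)
  then show ?thesis
    using layers by (intro LIMSEQ_le_const[of _ "LINT x|?M. h x"]) (auto intro!: exI[of _ 1])
qed

text \<open>For functions with values between 0 and 1 the reverse inequality is the previous one applied
  to \<open>1 - g\<close>, because the measure has the right total mass; an affine change of values then
  covers every continuous function.\<close>
lemma integral_representing_measure:
  assumes h: "continuous_on K h"
  shows "(LINT x|representing_measure. h x) = F h"
proof -
  let ?M = representing_measure
  interpret finite_measure ?M by (rule finite_measure_representing_measure)
  have mass: "measure ?M K = mass"
    using emeasure_representing_measure_domain mass_nonneg by (simp add: measure_def)
  have unit: "F g = (LINT x|?M. g x)"
    if g: "continuous_on K g" and g01: "\<And>x. x \<in> K \<Longrightarrow> 0 \<le> g x \<and> g x \<le> 1" for g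
  proof (rule antisym)
    show "F g \<le> (LINT x|?M. g x)" by (rule functional_le_integral[OF g g01])
    have "F (\<lambda>x. 1 - g x) \<le> (LINT x|?M. 1 - g x)"
      using g01 by (intro functional_le_integral continuous_intros g) auto
    moreover have "F (\<lambda>x. 1 - g x) = mass - F g"
      using diff[of "\<lambda>x. 1" g] g const[of 1] by simp
    moreover have "(LINT x|?M. 1 - g x) = mass - (LINT x|?M. g x)"
      using integrable_representing_measure[OF g] mass
      by (subst Bochner_Integration.integral_diff) (auto simp: space_representing_measure)
    ultimately show "(LINT x|?M. g x) \<le> F g" by simp
  qed
  obtain B0 where B0: "\<And>x. x \<in> K \<Longrightarrow> norm (h x) \<le> B0"
    using compact_imp_bounded[OF compact_continuous_image[OF h compact_domain]]
    unfolding bounded_iff by auto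
  define B where "B = max B0 1"
  have B: "B > 0" "\<And>x. x \<in> K \<Longrightarrow> \<bar>h x\<bar> \<le> B" using B0 unfolding B_def by (auto intro: max.coboundedI1)
  define g where "g x = 1 / (2 * B) * h x + 1 / 2" for x
  have g: "continuous_on K g" unfolding g_def by (intro continuous_intros h)
  have "0 \<le> g x \<and> g x \<le> 1" if "x \<in> K" for x
    using B(2)[OF that] B(1) unfolding g_def by (auto simp: field_simps abs_le_iff)
  from unit[OF g this] have "F g = (LINT x|?M. g x)" by simp
  moreover have "F g = 1 / (2 * B) * F h + mass / 2"
  proof -
    have "continuous_on K (\<lambda>x. 1 / (2 * B) * h x)" using h by (intro continuous_intros)
    then show ?thesis
      unfolding g_def using add[of "\<lambda>x. 1 / (2 * B) * h x" "\<lambda>x. 1 / 2"]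
        scale[OF h, of "1 / (2 * B)"] const[of "1/2"] by simp
  qed
  moreover have "(LINT x|?M. g x) = 1 / (2 * B) * (LINT x|?M. h x) + mass / 2"
    unfolding g_def using integrable_representing_measure[OF h] mass
    by (subst Bochner_Integration.integral_add) (auto simp: space_representing_measure)
  ultimately show ?thesis using B(1) by simp
qed

end

text \<open>A functional on families of continuous functions that is monotone in the values taken on
  \<open>J \<times> K\<close> splits into one positive functional per index, each fed with families that vanish
  at all other indices, so the representation on a single compact set applies to each summand. The
  hypothesis on the sign also shows that values of the families off \<open>J \<times> K\<close> do not matter.\<close>
theorem Riesz_representation_family:
  fixes K :: "'a::euclidean_space set" and J :: "'j set"
  defines "V \<equiv> {h :: 'j \<times> 'a \<Rightarrow> real. \<forall>j\<in>J. continuous_on K (\<lambda>q. h (j, q))}"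
  assumes J: "finite J" and K: "compact K" and lin: "linear_functional_on V F"
    and pos: "\<And>h. h \<in> V \<Longrightarrow> (\<And>j q. j \<in> J \<Longrightarrow> q \<in> K \<Longrightarrow> h (j, q) \<le> 0) \<Longrightarrow> F h \<le> 0"
  obtains \<mu> where "\<And>j. j \<in> J \<Longrightarrow> \<mu> j \<in> nonneg_borel_measures K"
    "\<And>h. h \<in> V \<Longrightarrow> F h = (\<Sum>j\<in>J. LINT q|\<mu> j. h (j, q))"
proof -
  have F_add: "F (\<lambda>x. g x + h x) = F g + F h" if "g \<in> V" "h \<in> V" for g h
    using lin that by (simp add: linear_functional_on_def)
  have F_scale: "F (\<lambda>x. c * h x) = c * F h" if "h \<in> V" for h c
    using lin that by (simp add: linear_functional_on_def)
  have V_zero: "(\<lambda>x. 0) \<in> V" by (simp add: V_def)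
  have F_zero: "F (\<lambda>x. 0) = 0" using F_scale[OF V_zero, of 0] by simp
  define embed where "embed j h = (\<lambda>x :: 'j \<times> 'a. if fst x = j then h (snd x) else 0 :: real)" for j h
  have embed_V: "embed j h \<in> V" if "continuous_on K h" for j h
  proof -
    have "continuous_on K (\<lambda>q. embed j h (i, q))" for i
      using that by (cases "i = j") (simp_all add: embed_def)
    then show ?thesis by (simp add: V_def)
  qed
  have F_eq: "F g = F h" if gh: "g \<in> V" "h \<in> V"
    and eq: "\<And>j q. j \<in> J \<Longrightarrow> q \<in> K \<Longrightarrow> g (j, q) = h (j, q)" for g h
  proof -
    have le: "F g \<le> F h" if gh: "g \<in> V" "h \<in> V"
      and eq: "\<And>j q. j \<in> J \<Longrightarrow> q \<in> K \<Longrightarrow> g (j, q) = h (j, q)" for g h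
    proof -
      have mh: "(\<lambda>x. -1 * h x) \<in> V" using gh by (auto simp: V_def intro!: continuous_intros)
      have "(\<lambda>x. g x + -1 * h x) \<in> V" using gh by (auto simp: V_def intro!: continuous_intros)
      then have "F (\<lambda>x. g x + -1 * h x) \<le> 0" by (rule pos) (simp add: eq)
      then show ?thesis using F_add[OF gh(1) mh] F_scale[OF gh(2), of "-1"] by simp
    qed
    show ?thesis using le[of g h] le[of h g] gh eq by simp
  qed
  have Riesz: "\<exists>\<nu>\<in>nonneg_borel_measures K. \<forall>h. continuous_on K h \<longrightarrow> F (embed j h) = (LINT q|\<nu>. h q)"
    for j
  proof -
    interpret R: positive_functional K "\<lambda>h. F (embed j h)"
    proof
      fix g h :: "'a \<Rightarrow> real" assume "continuous_on K g" "continuous_on K h"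
      moreover have "embed j (\<lambda>x. g x + h x) = (\<lambda>x. embed j g x + embed j h x)"
        by (auto simp: embed_def)
      ultimately show "F (embed j (\<lambda>x. g x + h x)) = F (embed j g) + F (embed j h)"
        using F_add embed_V by simp
    next
      fix h :: "'a \<Rightarrow> real" and c assume "continuous_on K h"
      moreover have "embed j (\<lambda>x. c * h x) = (\<lambda>x. c * embed j h x)"
        by (auto simp: embed_def)
      ultimately show "F (embed j (\<lambda>x. c * h x)) = c * F (embed j h)"
        using F_scale embed_V by simp
    next
      fix h :: "'a \<Rightarrow> real" assume h: "continuous_on K h" "\<And>x. x \<in> K \<Longrightarrow> 0 \<le> h x"
      have "(\<lambda>x. -1 * embed j h x) \<in> V"
        using embed_V[OF h(1), of j] by (auto simp: V_def intro!: continuous_intros)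
      then have "F (\<lambda>x. -1 * embed j h x) \<le> 0" by (rule pos) (simp add: embed_def h)
      then show "0 \<le> F (embed j h)" using F_scale[OF embed_V[OF h(1)], of "-1" j] by simp
    qed (rule K)
    show ?thesis
      using R.representing_measure_in R.integral_representing_measure by metis
  qed
  then obtain \<mu> where \<mu>: "\<And>j. \<mu> j \<in> nonneg_borel_measures K"
    "\<And>j h. continuous_on K h \<Longrightarrow> F (embed j h) = (LINT q|\<mu> j. h q)"
    by metis
  have "F h = (\<Sum>j\<in>J. LINT q|\<mu> j. h (j, q))" if h: "h \<in> V" for h
  proof -
    have hj: "continuous_on K (\<lambda>q. h (j, q))" if "j \<in> J" for j using h that by (simp add: V_def)
    have sum_V: "(\<lambda>x. \<Sum>j\<in>I. embed j (\<lambda>q. h (j, q)) x) \<in> V" if "I \<subseteq> J" for I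
      using embed_V hj that unfolding V_def by (auto intro!: continuous_intros)
    have split: "F (\<lambda>x. \<Sum>j\<in>I. embed j (\<lambda>q. h (j, q)) x) = (\<Sum>j\<in>I. F (embed j (\<lambda>q. h (j, q))))"
      if "finite I" "I \<subseteq> J" for I
      using that
    proof (induction I rule: finite_induct)
      case empty
      show ?case using F_zero by simp
    next
      case (insert i I)
      then show ?case using F_add[OF embed_V[OF hj, of i i] sum_V[of I]] by simp
    qed
    have "F h = F (\<lambda>x. \<Sum>j\<in>J. embed j (\<lambda>q. h (j, q)) x)"
    proof (rule F_eq[OF h sum_V[OF order_refl]])
      fix j q assume "j \<in> J"
      then show "h (j, q) = (\<Sum>i\<in>J. embed i (\<lambda>q. h (i, q)) (j, q))"
        using J by (simp add: embed_def)
    qed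
    also have "\<dots> = (\<Sum>j\<in>J. LINT q|\<mu> j. h (j, q))"
      using split[OF J] \<mu>(2)[OF hj] by simp
    finally show ?thesis .
  qed
  with \<mu>(1) show thesis by (rule that)
qed

section \<open>Derivatives of test functions along vector fields\<close>

text \<open>The rate of change of \<open>v\<close> along a trajectory through \<open>q\<close> with velocity \<open>w\<close>, the
  integrand of the Liouville equation. Since it is the Frechet derivative of \<open>v\<close> evaluated at
  \<open>(1, w)\<close>, all its properties come from the derivative as a bounded linear map.\<close>
definition orbital_derivative ::
  "(real \<times> (real ^ 'n) \<Rightarrow> real) \<Rightarrow> real \<times> (real ^ 'n) \<Rightarrow> real ^ 'n \<Rightarrow> real" where
  "orbital_derivative v q w = partial_t v q + partial_x v q w"

lemma orbital_derivative_eq: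
  fixes v :: "real \<times> (real ^ 'n) \<Rightarrow> real"
  assumes v: "(v has_derivative D) (at q)"
  shows "orbital_derivative v q w = D (1, w)"
proof -
  obtain t x where q: "q = (t, x)" by fastforce
  interpret D: bounded_linear D using v by (rule has_derivative_bounded_linear)
  have "((\<lambda>s. (s, x)) has_derivative (\<lambda>h. (h, 0))) (at t)" by (auto intro!: derivative_eq_intros)
  from has_derivative_compose[OF this, of v D] v
  have "((\<lambda>s. v (s, x)) has_derivative (\<lambda>h. D (h, 0))) (at t)" by (simp add: q)
  moreover have "(\<lambda>h. D (h, 0)) = (*) (D (1, 0))"
  proof
    fix h show "D (h, 0) = D (1, 0) * h" using D.scaleR[of h "(1, 0)"] by simp
  qed
  ultimately have "((\<lambda>s. v (s, x)) has_field_derivative D (1, 0)) (at t)"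
    by (simp add: has_field_derivative_def)
  then have t: "partial_t v q = D (1, 0)" by (simp add: partial_t_def q DERIV_imp_deriv)
  have "((\<lambda>y. (t, y)) has_derivative (\<lambda>h. (0, h))) (at x)" by (auto intro!: derivative_eq_intros)
  from has_derivative_compose[OF this, of v D] v
  have "((\<lambda>y. v (t, y)) has_derivative (\<lambda>h. D (0, h))) (at x)" by (simp add: q)
  then have "frechet_derivative (\<lambda>y. v (t, y)) (at x) = (\<lambda>h. D (0, h))"
    by (metis frechet_derivative_at)
  then have x: "partial_x v q w = D (0, w)" by (simp add: partial_x_def q)
  show ?thesis using t x D.add[of "(1, 0)" "(0, w)"] by (simp add: orbital_derivative_def)
qed

lemma continuously_differentiableE:
  assumes "continuously_differentiable v"
  obtains D where "\<And>q. (v has_derivative blinfun_apply (D q)) (at q)" "continuous_on UNIV D"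
    "\<And>q w. orbital_derivative v q w = blinfun_apply (D q) (1, w)"
  using assms orbital_derivative_eq unfolding continuously_differentiable_def by metis

lemma continuous_on_orbital_derivative:
  assumes v: "continuously_differentiable v" and f: "continuous_on K f"
  shows "continuous_on K (\<lambda>q. orbital_derivative v q (f q))"
proof -
  obtain D where "\<And>q. (v has_derivative blinfun_apply (D q)) (at q)"
    and D: "continuous_on UNIV D" "\<And>q w. orbital_derivative v q w = blinfun_apply (D q) (1, w)"
    using continuously_differentiableE[OF v] by metis
  have "continuous_on K (\<lambda>q. blinfun_apply (D q) (1, f q))"
    using continuous_on_subset[OF D(1)] f by (intro continuous_intros) auto
  then show ?thesis by (simp add: D(2))
qed

lemma continuously_differentiable_add:
  assumes "continuously_differentiable v" "continuously_differentiable w"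
  shows "continuously_differentiable (\<lambda>q. v q + w q)"
    and "orbital_derivative (\<lambda>q. v q + w q) q d = orbital_derivative v q d + orbital_derivative w q d"
proof -
  obtain D where D: "\<And>q. (v has_derivative blinfun_apply (D q)) (at q)" "continuous_on UNIV D"
    "\<And>q d. orbital_derivative v q d = blinfun_apply (D q) (1, d)"
    using continuously_differentiableE[OF assms(1)] by metis
  obtain E where E: "\<And>q. (w has_derivative blinfun_apply (E q)) (at q)" "continuous_on UNIV E"
    "\<And>q d. orbital_derivative w q d = blinfun_apply (E q) (1, d)"
    using continuously_differentiableE[OF assms(2)] by metis
  have der: "((\<lambda>q. v q + w q) has_derivative blinfun_apply (D q + E q)) (at q)" for q
    using has_derivative_add[OF D(1) E(1)] by (simp add: plus_blinfun.rep_eq)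
  moreover have "continuous_on UNIV (\<lambda>q. D q + E q)" using D(2) E(2) by (intro continuous_intros)
  ultimately show "continuously_differentiable (\<lambda>q. v q + w q)"
    unfolding continuously_differentiable_def by (intro exI[of _ "\<lambda>q. D q + E q"]) auto
  show "orbital_derivative (\<lambda>q. v q + w q) q d = orbital_derivative v q d + orbital_derivative w q d"
    using orbital_derivative_eq[OF der] D(3) E(3) by (simp add: plus_blinfun.rep_eq)
qed

lemma continuously_differentiable_scale:
  assumes "continuously_differentiable v"
  shows "continuously_differentiable (\<lambda>q. c * v q)"
    and "orbital_derivative (\<lambda>q. c * v q) q d = c * orbital_derivative v q d"
proof -
  obtain D where D: "\<And>q. (v has_derivative blinfun_apply (D q)) (at q)" "continuous_on UNIV D"
    "\<And>q d. orbital_derivative v q d = blinfun_apply (D q) (1, d)"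
    using continuously_differentiableE[OF assms(1)] by metis
  have der: "((\<lambda>q. c * v q) has_derivative blinfun_apply (c *\<^sub>R D q)) (at q)" for q
    using has_derivative_mult_right[OF D(1), of c] by (simp add: scaleR_blinfun.rep_eq)
  moreover have "continuous_on UNIV (\<lambda>q. c *\<^sub>R D q)" using D(2) by (intro continuous_intros)
  ultimately show "continuously_differentiable (\<lambda>q. c * v q)"
    unfolding continuously_differentiable_def by (intro exI[of _ "\<lambda>q. c *\<^sub>R D q"]) auto
  show "orbital_derivative (\<lambda>q. c * v q) q d = c * orbital_derivative v q d"
    using orbital_derivative_eq[OF der] D(3) by (simp add: scaleR_blinfun.rep_eq)
qed

text \<open>Multiples of the time variable have constant rates whatever the dynamics; they provide
  dominating test functions for every bounded integrand.\<close>
lemma continuously_differentiable_time: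
  fixes c :: real and q :: "real \<times> (real ^ 'n)"
  shows "continuously_differentiable (\<lambda>q :: real \<times> (real ^ 'n). c * fst q)"
    and "orbital_derivative (\<lambda>q. c * fst q) q w = c"
proof -
  have der: "((\<lambda>q :: real \<times> (real ^ 'n). c * fst q) has_derivative
      blinfun_apply (Blinfun (\<lambda>h. c * fst h))) (at q)" for q
  proof -
    have "bounded_linear (\<lambda>h :: real \<times> (real ^ 'n). c * fst h)"
      by (intro bounded_linear_const_mult bounded_linear_fst)
    then show ?thesis
      by (auto simp: bounded_linear_Blinfun_apply intro!: derivative_eq_intros)
  qed
  then show "continuously_differentiable (\<lambda>q :: real \<times> (real ^ 'n). c * fst q)"
    unfolding continuously_differentiable_def by (intro exI[of _ "\<lambda>q. Blinfun (\<lambda>h. c * fst h)"]) auto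
  have "((\<lambda>q :: real \<times> (real ^ 'n). c * fst q) has_derivative (\<lambda>h. c * fst h)) (at q)"
    by (auto intro!: derivative_eq_intros)
  from orbital_derivative_eq[OF this] show "orbital_derivative (\<lambda>q. c * fst q) q w = c" by simp
qed

section \<open>The pricing functional and strong duality\<close>

locale feasible_transport =
  fixes T :: real and X :: "(real ^ 'n) set" and x0 xT :: "real ^ 'n" and m :: nat
    and f :: "nat \<Rightarrow> real \<times> (real ^ 'n) \<Rightarrow> real ^ 'n"
  assumes compact_X: "compact X"
    and cont_f: "\<And>j. j \<in> {1..m} \<Longrightarrow> continuous_on (time_state_set T X) (f j)"
    and feasible: "\<exists>\<mu>. primal_admissible T X x0 xT m f \<mu>"
begin

abbreviation "K \<equiv> time_state_set T X"

lemma compact_K: "compact K"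
  unfolding time_state_set_def using compact_X by (intro compact_Times) auto

text \<open>Families of continuous functions on \<open>K\<close>, indexed by the modes. Only the restrictions to
  \<open>K\<close> are constrained, since this is where the dynamics and the costs are given.\<close>
definition costs :: "(nat \<times> (real \<times> (real ^ 'n)) \<Rightarrow> real) set" where
  "costs = {h. \<forall>j\<in>{1..m}. continuous_on K (\<lambda>q. h (j, q))}"

definition gain :: "(real \<times> (real ^ 'n) \<Rightarrow> real) \<Rightarrow> real" where
  "gain v = v (T, xT) - v (0, x0)"

text \<open>Up to the sign of \<open>v\<close>, the dual feasible set for the running costs \<open>- h\<close>.\<close>
definition dominators :: "(nat \<times> (real \<times> (real ^ 'n)) \<Rightarrow> real) \<Rightarrow> (real \<times> (real ^ 'n) \<Rightarrow> real) set" where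
  "dominators h = {v. continuously_differentiable v \<and>
     (\<forall>j\<in>{1..m}. \<forall>q\<in>K. h (j, q) \<le> orbital_derivative v q (f j q))}"

text \<open>The negative of the dual value as a function of the running costs \<open>- h\<close>. Extending the
  functional that maps the rates of \<open>v\<close> to the gain of \<open>v\<close> to all of \<open>costs\<close> below this
  sublinear bound is what produces optimal measures.\<close>
definition price :: "(nat \<times> (real \<times> (real ^ 'n)) \<Rightarrow> real) \<Rightarrow> real" where
  "price h = (INF v\<in>dominators h. gain v)"

lemma function_subspace_costs: "function_subspace costs"
proof -
  have "(\<lambda>x. 0) \<in> costs" by (simp add: costs_def)
  then show ?thesis
    unfolding function_subspace_def by (auto simp: costs_def intro!: continuous_intros)
qed

lemma rates_in_costs:
  "continuously_differentiable v \<Longrightarrow> (\<lambda>(j, q). orbital_derivative v q (f j q)) \<in> costs"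
  using continuous_on_orbital_derivative[OF _ cont_f] by (simp add: costs_def)

lemma primal_admissible_iff:
  "primal_admissible T X x0 xT m f \<mu> \<longleftrightarrow>
     (\<forall>j\<in>{1..m}. \<mu> j \<in> nonneg_borel_measures K) \<and>
     (\<forall>v. continuously_differentiable v \<longrightarrow>
        gain v = (\<Sum>j=1..m. LINT q|\<mu> j. orbital_derivative v q (f j q)))"
  by (simp add: primal_admissible_def gain_def orbital_derivative_def)

text \<open>Weak duality in homogeneous form: integrate the domination against an admissible vector.\<close>
lemma integral_le_gain:
  assumes \<mu>: "primal_admissible T X x0 xT m f \<mu>" and h: "h \<in> costs" and v: "v \<in> dominators h"
  shows "(\<Sum>j=1..m. LINT q|\<mu> j. h (j, q)) \<le> gain v"
proof -
  have cd: "continuously_differentiable v" using v by (simp add: dominators_def)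
  have "(\<Sum>j=1..m. LINT q|\<mu> j. h (j, q)) \<le> (\<Sum>j=1..m. LINT q|\<mu> j. orbital_derivative v q (f j q))"
  proof (rule sum_mono)
    fix j assume j: "j \<in> {1..m}"
    then have \<mu>j: "\<mu> j \<in> nonneg_borel_measures K" using \<mu> by (simp add: primal_admissible_iff)
    show "(LINT q|\<mu> j. h (j, q)) \<le> (LINT q|\<mu> j. orbital_derivative v q (f j q))"
    proof (rule integral_mono)
      show "integrable (\<mu> j) (\<lambda>q. h (j, q))"
        using h j by (intro integrable_continuous_nonneg_borel_measure[OF \<mu>j compact_K])
          (simp add: costs_def)
      show "integrable (\<mu> j) (\<lambda>q. orbital_derivative v q (f j q))"
        by (intro integrable_continuous_nonneg_borel_measure[OF \<mu>j compact_K]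
            continuous_on_orbital_derivative cd cont_f j)
      show "h (j, q) \<le> orbital_derivative v q (f j q)" if "q \<in> space (\<mu> j)" for q
        using that v j by (simp add: dominators_def space_nonneg_borel_measure[OF \<mu>j])
    qed
  qed
  also have "\<dots> = gain v" using \<mu> cd by (simp add: primal_admissible_iff)
  finally show ?thesis .
qed

lemma dominators_nonempty:
  assumes h: "h \<in> costs"
  shows "dominators h \<noteq> {}"
proof -
  have "\<exists>B. \<forall>q\<in>K. h (j, q) \<le> B" if "j \<in> {1..m}" for j
  proof -
    have "continuous_on K (\<lambda>q. h (j, q))" using h that by (simp add: costs_def)
    from compact_imp_bounded[OF compact_continuous_image[OF this compact_K]]
    show ?thesis unfolding bounded_iff by (auto simp: abs_le_iff)
  qed
  then obtain B where B: "\<And>j q. j \<in> {1..m} \<Longrightarrow> q \<in> K \<Longrightarrow> h (j, q) \<le> B j" by metis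
  define c where "c = (\<Sum>j=1..m. \<bar>B j\<bar>)"
  have "h (j, q) \<le> c" if "j \<in> {1..m}" "q \<in> K" for j q
  proof -
    have "\<bar>B j\<bar> \<le> c" unfolding c_def using that by (intro member_le_sum) auto
    then show ?thesis using B[OF that] by simp
  qed
  then have "(\<lambda>q. c * fst q) \<in> dominators h"
    by (simp add: dominators_def continuously_differentiable_time)
  then show ?thesis by blast
qed

text \<open>Feasibility enters here: by weak duality any one admissible vector bounds the gains of all
  dominating test functions from below, so the infimum defining the price is finite.\<close>
lemma price_le: "h \<in> costs \<Longrightarrow> v \<in> dominators h \<Longrightarrow> price h \<le> gain v"
proof -
  assume h: "h \<in> costs" and v: "v \<in> dominators h"
  obtain \<mu> where "primal_admissible T X x0 xT m f \<mu>" using feasible by blast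
  from integral_le_gain[OF this h]
  have "bdd_below (gain ` dominators h)" by (rule bdd_belowI2)
  then show "price h \<le> gain v" unfolding price_def using v by (rule cINF_lower)
qed

lemma price_greatest:
  "h \<in> costs \<Longrightarrow> (\<And>v. v \<in> dominators h \<Longrightarrow> a \<le> gain v) \<Longrightarrow> a \<le> price h"
  unfolding price_def using dominators_nonempty by (intro cINF_greatest)

lemma sublinear_on_price: "sublinear_on costs price"
proof -
  have "price (\<lambda>x. g x + h x) \<le> price g + price h" if g: "g \<in> costs" and h: "h \<in> costs" for g h
  proof -
    have gh: "(\<lambda>x. g x + h x) \<in> costs" by (rule function_subspace_add[OF function_subspace_costs g h])
    have *: "price (\<lambda>x. g x + h x) \<le> gain v + gain w"
      if v: "v \<in> dominators g" and w: "w \<in> dominators h" for v w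
    proof -
      have cd: "continuously_differentiable v" "continuously_differentiable w"
        using v w by (simp_all add: dominators_def)
      have "(\<lambda>q. v q + w q) \<in> dominators (\<lambda>x. g x + h x)"
        using v w continuously_differentiable_add[OF cd] by (auto simp: dominators_def intro: add_mono)
      from price_le[OF gh this] show ?thesis by (simp add: gain_def)
    qed
    have "price (\<lambda>x. g x + h x) - price h \<le> price g"
    proof (rule price_greatest[OF g])
      fix v assume v: "v \<in> dominators g"
      have "price (\<lambda>x. g x + h x) - gain v \<le> price h"
        by (rule price_greatest[OF h]) (use *[OF v] in \<open>simp add: algebra_simps\<close>)
      then show "price (\<lambda>x. g x + h x) - price h \<le> gain v" by simp
    qed
    then show ?thesis by simp
  qed
  moreover have "price (\<lambda>x. c * h x) \<le> c * price h" if h: "h \<in> costs" and c: "c > 0" for h c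
  proof -
    have ch: "(\<lambda>x. c * h x) \<in> costs" by (rule function_subspace_scale[OF function_subspace_costs h])
    have "price (\<lambda>x. c * h x) / c \<le> price h"
    proof (rule price_greatest[OF h])
      fix v assume v: "v \<in> dominators h"
      then have cd: "continuously_differentiable v" by (simp add: dominators_def)
      have "(\<lambda>q. c * v q) \<in> dominators (\<lambda>x. c * h x)"
        using v c continuously_differentiable_scale[OF cd] by (auto simp: dominators_def)
      from price_le[OF ch this] c show "price (\<lambda>x. c * h x) / c \<le> gain v"
        by (simp add: gain_def field_simps)
    qed
    then show ?thesis using c by (simp add: field_simps)
  qed
  ultimately show ?thesis unfolding sublinear_on_def by blast
qed

text \<open>The core of the duality: a linear functional below the price that touches it at \<open>y\<close> is
  automatically given by an admissible vector of measures. It is monotone because the zero function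
  dominates every nonpositive family. Every test function dominates its own rates, so the
  functional is at most the gain there; applied to \<open>v\<close> and \<open>- v\<close> this yields the
  Liouville equation.\<close>
lemma ex_measures_attaining_price:
  assumes y: "y \<in> costs"
  obtains \<mu> where "primal_admissible T X x0 xT m f \<mu>"
    "(\<Sum>j=1..m. LINT q|\<mu> j. y (j, q)) = price y"
proof -
  obtain F where lin: "linear_functional_on costs F" and le: "\<And>h. h \<in> costs \<Longrightarrow> F h \<le> price h"
    and Fy: "F y = price y"
    using Hahn_Banach_sublinear[OF function_subspace_costs sublinear_on_price y] by blast
  have pos: "F h \<le> 0" if h: "h \<in> costs" and "\<And>j q. j \<in> {1..m} \<Longrightarrow> q \<in> K \<Longrightarrow> h (j, q) \<le> 0" for h
  proof -
    have "(\<lambda>q. 0 * fst q) \<in> dominators h"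
      using that(2) by (simp only: dominators_def continuously_differentiable_time mem_Collect_eq) blast
    from price_le[OF h this] le[OF h] show ?thesis by (simp add: gain_def)
  qed
  obtain \<mu> where \<mu>: "\<And>j. j \<in> {1..m} \<Longrightarrow> \<mu> j \<in> nonneg_borel_measures K"
    and rep: "\<And>h. h \<in> costs \<Longrightarrow> F h = (\<Sum>j=1..m. LINT q|\<mu> j. h (j, q))"
    using Riesz_representation_family[OF _ compact_K lin[unfolded costs_def] pos[unfolded costs_def]]
    unfolding costs_def[symmetric] by blast
  have balance_le: "(\<Sum>j=1..m. LINT q|\<mu> j. orbital_derivative v q (f j q)) \<le> gain v"
    if v: "continuously_differentiable v" for v
  proof -
    have "v \<in> dominators (\<lambda>(j, q). orbital_derivative v q (f j q))" using v by (simp add: dominators_def)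
    from price_le[OF rates_in_costs[OF v] this] le[OF rates_in_costs[OF v]] rep[OF rates_in_costs[OF v]]
    show ?thesis by simp
  qed
  have "gain v = (\<Sum>j=1..m. LINT q|\<mu> j. orbital_derivative v q (f j q))"
    if v: "continuously_differentiable v" for v
  proof (rule antisym[OF _ balance_le[OF v]])
    have "(\<Sum>j=1..m. LINT q|\<mu> j. orbital_derivative (\<lambda>q. -1 * v q) q (f j q)) \<le> gain (\<lambda>q. -1 * v q)"
      by (rule balance_le[OF continuously_differentiable_scale(1)[OF v]])
    then show "gain v \<le> (\<Sum>j=1..m. LINT q|\<mu> j. orbital_derivative v q (f j q))"
      by (simp add: continuously_differentiable_scale(2)[OF v, of "-1", simplified] gain_def sum_negf)
  qed
  with \<mu> have "primal_admissible T X x0 xT m f \<mu>" by (simp add: primal_admissible_iff)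
  moreover have "(\<Sum>j=1..m. LINT q|\<mu> j. y (j, q)) = price y" using rep[OF y] Fy by simp
  ultimately show thesis by (rule that)
qed

lemma dual_admissible_iff:
  "dual_admissible T X m f l v \<longleftrightarrow> (\<lambda>q. -1 * v q) \<in> dominators (\<lambda>(j, q). - l j q)"
proof -
  have "continuously_differentiable (\<lambda>q. -1 * v q) \<longleftrightarrow> continuously_differentiable v"
    using continuously_differentiable_scale(1)[of v "-1"]
      continuously_differentiable_scale(1)[of "\<lambda>q. -1 * v q" "-1"] by auto
  moreover have "0 \<le> l j q - partial_t v q - partial_x v q (f j q) \<longleftrightarrow>
      - l j q \<le> orbital_derivative (\<lambda>q. -1 * v q) q (f j q)"
    if "continuously_differentiable v" for j q
    unfolding continuously_differentiable_scale(2)[OF that, of "-1"]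
    by (auto simp: orbital_derivative_def)
  ultimately show ?thesis
    unfolding dual_admissible_def dominators_def mem_Collect_eq prod.case by blast
qed

end

theorem theorem3:
  fixes T :: real and X :: "(real ^ 'n) set" and x0 xT :: "real ^ 'n" and m :: nat
    and f :: "nat \<Rightarrow> real \<times> (real ^ 'n) \<Rightarrow> real ^ 'n"
    and l :: "nat \<Rightarrow> real \<times> (real ^ 'n) \<Rightarrow> real"
  assumes "T > 0"
    and "compact X"
    and "\<And>j. j \<in> {1..m} \<Longrightarrow> continuous_on (time_state_set T X) (f j)"
    and "\<And>j. j \<in> {1..m} \<Longrightarrow> continuous_on (time_state_set T X) (l j)"
    and "\<And>j t. j \<in> {1..m} \<Longrightarrow> t \<in> {0..T} \<Longrightarrow> \<exists>L. L-lipschitz_on X (\<lambda>x. f j (t, x))"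
    and "\<And>j t. j \<in> {1..m} \<Longrightarrow> t \<in> {0..T} \<Longrightarrow> \<exists>L. L-lipschitz_on X (\<lambda>x. l j (t, x))"
    and "\<exists>\<mu>. primal_admissible T X x0 xT m f \<mu>"
  shows "primal_value T X x0 xT m f l = dual_value T X x0 xT m f l"
proof -
  interpret feasible_transport T X x0 xT m f
    using assms by unfold_locales auto
  define y :: "nat \<times> (real \<times> (real ^ 'n)) \<Rightarrow> real" where "y = (\<lambda>(j, q). - l j q)"
  have y: "y \<in> costs" using assms(4) by (auto simp: costs_def y_def intro!: continuous_intros)
  have gain_uminus: "gain (\<lambda>q. -1 * v q) = - gain v" for v by (simp add: gain_def)
  show ?thesis
  proof (rule antisym)
    obtain \<mu> where \<mu>: "primal_admissible T X x0 xT m f \<mu>"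
      "(\<Sum>j=1..m. LINT q|\<mu> j. y (j, q)) = price y"
      using ex_measures_attaining_price[OF y] by blast
    have "primal_value T X x0 xT m f l \<le> ereal (\<Sum>j=1..m. LINT q|\<mu> j. l j q)"
      unfolding primal_value_def using \<mu>(1) by (intro INF_lower) simp
    also have "(\<Sum>j=1..m. LINT q|\<mu> j. l j q) = - price y"
      using \<mu>(2) by (simp add: y_def sum_negf)
    also have "ereal (- price y) \<le> dual_value T X x0 xT m f l"
    proof (rule ereal_le_real)
      fix d assume d: "dual_value T X x0 xT m f l \<le> ereal d"
      \<comment> \<open>Every function that dominates \<open>- l\<close> is the negative of a dual admissible one.\<close>
      have "- d \<le> price y"
      proof (rule price_greatest[OF y])
        fix v assume v: "v \<in> dominators y"
        then have "dual_admissible T X m f l (\<lambda>q. -1 * v q)" by (simp add: dual_admissible_iff y_def)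
        then have "ereal (gain (\<lambda>q. -1 * v q)) \<le> dual_value T X x0 xT m f l"
          unfolding dual_value_def gain_def by (intro SUP_upper) simp
        with d have "gain (\<lambda>q. -1 * v q) \<le> d" by (metis ereal_less_eq(3) order_trans)
        then show "- d \<le> gain v" unfolding gain_uminus by simp
      qed
      then show "ereal (- price y) \<le> ereal d" by simp
    qed
    finally show "primal_value T X x0 xT m f l \<le> dual_value T X x0 xT m f l" .
  next
    show "dual_value T X x0 xT m f l \<le> primal_value T X x0 xT m f l"
      unfolding dual_value_def primal_value_def
    proof (intro SUP_least INF_greatest, clarify)
      fix v \<mu> assume v: "dual_admissible T X m f l v" and \<mu>: "primal_admissible T X x0 xT m f \<mu>"
      have "(\<Sum>j=1..m. LINT q|\<mu> j. y (j, q)) \<le> gain (\<lambda>q. -1 * v q)"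
        using v by (intro integral_le_gain[OF \<mu> y]) (simp add: dual_admissible_iff y_def)
      then show "ereal (v (T, xT) - v (0, x0)) \<le> ereal (\<Sum>j=1..m. LINT q|\<mu> j. l j q)"
        unfolding gain_uminus by (simp add: y_def sum_negf gain_def)
    qed
  qed
qed

end
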